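(* Let $g:\mathbb{N}\to\mathbb{C}$ be an arithmetic function such that for every $\varepsilon>0$ one has $g(n)\ll_\varepsilon n^\varepsilon$ for all $n\geq 1$, and let $f=\mathrm{id}\ast g$, i.e. $f(n)=\sum_{d\mid n} d\, g(n/d)$. Then for any $\varepsilon>0$, \[ \sum_{n\leq x}\frac{f([x/n])}{[x/n]}= x\sum_{m\geq1}\frac{f(m)}{m^2(m+1)}+O(x^{1/3+\varepsilon}) \] as $x\rightarrow\infty$.
   Context: $[t]$ denotes the integral part of the real number $t$; $\mathrm{id}(n)=n$ for $n\ge1$, and $\ast$ denotes Dirichlet convolution. The implied constant may depend on $\varepsilon$. *)

theory Defs
  imports "HOL-Analysis.Analysis" "HOL-Library.Landau_Symbols"
begin

definition id_conv :: "(nat \<Rightarrow> complex) \<Rightarrow> nat \<Rightarrow> complex" where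
  "id_conv g n = (\<Sum>d | d dvd n. of_nat d * g (n div d))"

end

theory Submission
  imports Defs "HOL-Real_Asymp.Real_Asymp"
begin

text \<open>
  Since \<open>f(m)/m = \<Sum>\<^bsub>d|m\<^esub> g(d)/d\<close>, the sum equals \<open>\<Sum>\<^bsub>d\<le>x\<^esub> g(d)/d \<cdot> N\<^sub>d\<close>, where \<open>N\<^sub>d\<close> is the number of
  \<open>n \<le> x\<close> with \<open>d\<close> dividing \<open>[x/n]\<close>. It suffices to know \<open>N\<^sub>d\<close> up to \<open>O(x\<^bsup>1/3\<^esup> log\<^sup>2 x)\<close> uniformly
  in \<open>d \<le> x\<close>. Put \<open>y = x/d\<close>. For \<open>n \<le> \<surd>y\<close> the indicator of \<open>d | [x/n]\<close> is \<open>1/d - \<psi>(y/n) + \<psi>(y/n - 1/d)\<close>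
  with the sawtooth \<open>\<psi>\<close>; the \<open>n > \<surd>y\<close> are counted, for each \<open>k \<le> \<surd>y\<close>, in the interval
  \<open>y/(k + 1/d) < n \<le> y/k\<close>. All errors are thus sums of \<open>\<psi>(y/(n + \<alpha>) - \<beta>)\<close> over \<open>n \<le> \<surd>y\<close>.

  These are estimated by Vinogradov's elementary method. Near \<open>n\<close> approximate the slope
  \<open>y/(n + \<alpha>)\<^sup>2\<close> by a fraction \<open>a/q\<close> with \<open>q \<le> T \<approx> n/y\<^bsup>1/3\<^esup>\<close>; on a block of length \<open>q\<close> the argument
  runs through all residues modulo \<open>q\<close> up to \<open>O(1/q)\<close>, so the block contributes \<open>O(1)\<close>. Because the
  slope is strictly monotone, a given \<open>a/q\<close> serves only \<open>O(T\<^sup>2/q\<^sup>2)\<close> blocks.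
\<close>

section \<open>Sawtooth sums along arithmetic progressions modulo q\<close>

lemma bij_betw_affine_residues:
  fixes a b q :: int
  assumes "q > 0" "coprime a q"
  shows "bij_betw (\<lambda>j. (b + j * a) mod q) {0..<q} {0..<q}"
proof -
  have inj: "inj_on (\<lambda>j. (b + j * a) mod q) {0..<q}"
  proof (rule inj_onI)
    fix i j assume ij: "i \<in> {0..<q}" "j \<in> {0..<q}" "(b + i * a) mod q = (b + j * a) mod q"
    then have "q dvd (b + i * a) - (b + j * a)"
      by (simp add: mod_eq_dvd_iff)
    then have "q dvd a * (i - j)" by (simp add: algebra_simps)
    then have "q dvd i - j"
      using assms(2) by (simp add: coprime_commute coprime_dvd_mult_right_iff)
    then have "i mod q = j mod q" by (simp add: mod_eq_dvd_iff)
    then show "i = j" using ij by simp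
  qed
  have sub: "(\<lambda>j. (b + j * a) mod q) ` {0..<q} \<subseteq> {0..<q}"
    using assms(1) by auto
  have "(\<lambda>j. (b + j * a) mod q) ` {0..<q} = {0..<q}"
    by (rule endo_inj_surj[OF _ sub inj]) simp
  then show ?thesis using inj by (simp add: bij_betw_def)
qed

text \<open>Unless r lies within 2 of the left end or 3 of the right end of [0, q), adding u causes
  no wrap-around, and the error is just |u| / q. The range [-2, 3] for u is that of
  \<open>t + e j\<close> below, where t is a fractional part and
  \<open>\<bar>e j\<bar> \<le> 2\<close>.\<close>

lemma frac_near_residue:
  fixes r q u :: real
  assumes "0 \<le> r" "r < q" "-2 \<le> u" "u \<le> 3"
  shows "\<bar>frac ((r + u) / q) - r / q\<bar> \<le> 3 / q + (if r < 2 \<or> r + 3 \<ge> q then 1 else 0)"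
proof (cases "r < 2 \<or> r + 3 \<ge> q")
  case True
  have "0 \<le> r / q" "r / q \<le> 1" "0 \<le> 3 / q" using assms by auto
  moreover have "0 \<le> frac ((r + u) / q)" "frac ((r + u) / q) < 1"
    by (auto simp: frac_lt_1)
  ultimately have "\<bar>frac ((r + u) / q) - r / q\<bar> \<le> 3 / q + 1" by linarith
  then show ?thesis using True by simp
next
  case False
  then have "0 \<le> (r + u) / q" "(r + u) / q < 1" using assms by auto
  then have "frac ((r + u) / q) = (r + u) / q" by (simp add: frac_eq)
  then have "frac ((r + u) / q) - r / q = u / q" by (simp add: add_divide_distrib)
  moreover have "\<bar>u / q\<bar> \<le> 3 / q"
    using assms by (simp add: abs_divide divide_right_mono abs_le_iff)
  ultimately show ?thesis using False by simp
qed

definition sawtooth :: "real \<Rightarrow> real" where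
  "sawtooth t = frac t - 1 / 2"

lemma abs_sawtooth_le: "\<bar>sawtooth t\<bar> \<le> 1 / 2"
  using frac_ge_0[of t] frac_lt_1[of t] unfolding sawtooth_def by linarith

text \<open>The arguments hit every residue i modulo q once, up to a shift of size O(1/q), so the
  sum is compared with that of i/q - 1/2, which equals -1/2. The shifts cost 3/q each, hence 3 in
  all, and at most five residues near the ends cost 1 more each: 3 + 5 + 1/2 < 9.\<close>

lemma sum_sawtooth_rational_slope:
  fixes a :: int and q :: nat and c :: real and e :: "nat \<Rightarrow> real"
  assumes q: "q > 0" and cop: "coprime a (int q)" and e: "\<And>j. j < q \<Longrightarrow> \<bar>e j\<bar> \<le> 2"
  shows "\<bar>\<Sum>j<q. sawtooth (c + (of_int a * real j + e j) / real q)\<bar> \<le> 9"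
proof -
  \<comment> \<open>The integer part of c q only translates the residues; its fractional part t
    joins the perturbation.\<close>
  define b where "b = \<lfloor>c * real q\<rfloor>"
  define t where "t = c * real q - of_int b"
  have t: "0 \<le> t" "t < 1" unfolding t_def b_def by linarith+
  have c: "c = (of_int b + t) / real q" using q by (simp add: t_def)
  define r where "r j = (b + int j * a) mod int q" for j
  have bij: "bij_betw (\<lambda>j. nat (r j)) {..<q} {..<q}"
  proof -
    have "bij_betw ((\<lambda>j. (b + j * a) mod int q) \<circ> int) {..<q} {0..<int q}"
      by (rule bij_betw_trans[OF _ bij_betw_affine_residues])
         (use q cop in \<open>auto simp: bij_betw_def image_int_atLeastLessThan lessThan_atLeast0\<close>)
    moreover have "bij_betw nat {0..<int q} {..<q}"
      by (rule bij_betwI[of _ _ _ int]) auto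
    ultimately have "bij_betw (nat \<circ> ((\<lambda>j. (b + j * a) mod int q) \<circ> int)) {..<q} {..<q}"
      by (rule bij_betw_trans)
    then show ?thesis by (simp add: r_def o_def)
  qed
  have r: "0 \<le> r j" "r j < int q" for j using q by (auto simp: r_def)
  have *: "sawtooth (c + (of_int a * real j + e j) / real q)
      = frac ((of_int (r j) + (t + e j)) / real q) - 1 / 2" if "j < q" for j
  proof -
    define k where "k = (b + int j * a) div int q"
    have "b + int j * a = int q * k + r j" by (simp add: k_def r_def)
    then have "of_int (b + int j * a) = (of_int (int q * k + r j) :: real)" by simp
    then have eq: "of_int b + of_int a * real j = real q * of_int k + of_int (r j)"
      by (simp add: mult.commute)
    have "c + (of_int a * real j + e j) / real q
        = ((of_int b + of_int a * real j) + (t + e j)) / real q"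
      unfolding c by (simp add: add_divide_distrib)
    also have "\<dots> = (of_int (r j) + (t + e j)) / real q + of_int k"
      unfolding eq using q by (simp add: add_divide_distrib)
    finally have "c + (of_int a * real j + e j) / real q
        = (of_int (r j) + (t + e j)) / real q + of_int k" .
    then show ?thesis by (simp add: frac_def sawtooth_def)
  qed
  have "\<bar>(\<Sum>j<q. frac ((of_int (r j) + (t + e j)) / real q) - of_int (r j) / real q)\<bar>
      \<le> (\<Sum>j<q. 3 / real q + (if real (nat (r j)) < 2 \<or> real (nat (r j)) + 3 \<ge> real q then 1 else 0))"
  proof (rule order_trans[OF sum_abs sum_mono])
    fix j assume j: "j \<in> {..<q}"
    have "real (nat (r j)) = of_int (r j)" using r by simp
    moreover have "real_of_int (r j) < real q" using r(2)[of j] by linarith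
    ultimately show "\<bar>frac ((of_int (r j) + (t + e j)) / real q) - of_int (r j) / real q\<bar> \<le>
      3 / real q + (if real (nat (r j)) < 2 \<or> real (nat (r j)) + 3 \<ge> real q then 1 else 0)"
      using frac_near_residue[of "of_int (r j)" "real q" "t + e j"] r(1)[of j] t e[of j] j
      by (auto simp: abs_le_iff)
  qed
  also have "\<dots> = (\<Sum>i<q. 3 / real q + (if real i < 2 \<or> real i + 3 \<ge> real q then 1 else 0))"
    by (rule sum.reindex_bij_betw[OF bij])
  also have "\<dots> = 3 + real (card {i\<in>{..<q}. real i < 2 \<or> real i + 3 \<ge> real q})"
    using q by (simp add: sum.distrib sum.If_cases Int_def)
  also have "card {i\<in>{..<q}. real i < 2 \<or> real i + 3 \<ge> real q} \<le> card ({0, 1} \<union> {q-3..<q})"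
    by (rule card_mono) auto
  also have "card ({0, 1} \<union> {q-3..<q}) \<le> card {0::nat, 1} + card {q-3..<q}"
    by (rule card_Un_le)
  also have "\<dots> \<le> 5" by simp
  finally have A: "\<bar>(\<Sum>j<q. frac ((of_int (r j) + (t + e j)) / real q) - of_int (r j) / real q)\<bar> \<le> 8"
    by simp
  have "(\<Sum>j<q. of_int (r j) / real q - 1 / 2) = (\<Sum>j<q. real (nat (r j)) / real q - 1 / 2)"
    using r by simp
  also have "\<dots> = (\<Sum>i<q. real i / real q - 1 / 2)"
    by (rule sum.reindex_bij_betw[OF bij])
  also have "\<dots> = (\<Sum>i<q. real i) / real q - real q / 2"
    by (simp add: sum_subtractf sum_divide_distrib)
  also have "(\<Sum>i<q. real i) = real q * (real q - 1) / 2"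
    by (induction q) (auto simp: field_simps)
  finally have B: "(\<Sum>j<q. of_int (r j) / real q - 1 / 2) = - 1 / 2"
    using q by (simp add: field_simps)
  have "(\<Sum>j<q. sawtooth (c + (of_int a * real j + e j) / real q))
      = (\<Sum>j<q. (frac ((of_int (r j) + (t + e j)) / real q) - of_int (r j) / real q)
          + (of_int (r j) / real q - 1 / 2))"
    using * by (intro sum.cong) auto
  also have "\<dots> = (\<Sum>j<q. frac ((of_int (r j) + (t + e j)) / real q) - of_int (r j) / real q) + - 1 / 2"
    unfolding sum.distrib B by simp
  finally show ?thesis using A by linarith
qed

section \<open>Well-spaced sets and block decompositions\<close>

text \<open>Measured from the minimum of B, elements at distance at least q have different quotients
  by q, and these quotients lie between 0 and D/q.\<close>

lemma card_le_of_spacing: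
  fixes B :: "nat set" and D :: real
  assumes fin: "finite B" and q: "q > 0"
    and gap: "\<And>m n. m \<in> B \<Longrightarrow> n \<in> B \<Longrightarrow> m < n \<Longrightarrow> m + q \<le> n"
    and diam: "\<And>m n. m \<in> B \<Longrightarrow> n \<in> B \<Longrightarrow> m < n \<Longrightarrow> real n - real m \<le> D"
    and D: "D \<ge> 0"
  shows "real (card B) \<le> D / real q + 1"
proof (cases "B = {}")
  case True
  then show ?thesis using D by simp
next
  case False
  define m where "m = Min B"
  have m: "m \<in> B" "\<And>n. n \<in> B \<Longrightarrow> m \<le> n" using fin False by (auto simp: m_def)
  have inj: "inj_on (\<lambda>n. (n - m) div q) B"
  proof (rule linorder_inj_onI)
    fix i j assume ij: "i < j" "i \<in> B" "j \<in> B"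
    have "i - m + q \<le> j - m" using gap[OF ij(2,3,1)] m(2)[OF ij(2)] by simp
    then have "(i - m + q) div q \<le> (j - m) div q" by (rule div_le_mono)
    then show "(i - m) div q \<noteq> (j - m) div q" using q by simp
  qed auto
  have "(\<lambda>n. (n - m) div q) ` B \<subseteq> {..nat \<lfloor>D / real q\<rfloor>}"
  proof safe
    fix n assume n: "n \<in> B"
    have "real (n - m) \<le> D"
      using diam[OF m(1) n] m(2)[OF n] D by (cases "m = n") (auto simp: of_nat_diff)
    have "real ((n - m) div q) \<le> real (n - m) / real q" by (rule of_nat_div_le_of_nat)
    also have "\<dots> \<le> D / real q" using \<open>real (n - m) \<le> D\<close> by (simp add: divide_right_mono)
    finally show "(n - m) div q \<le> nat \<lfloor>D / real q\<rfloor>" by (simp add: le_nat_floor)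
  qed
  then have "card B \<le> card {..nat \<lfloor>D / real q\<rfloor>}"
    by (metis card_image card_mono finite_atMost inj)
  then have "real (card B) \<le> real (nat \<lfloor>D / real q\<rfloor>) + 1" by simp
  also have "\<dots> \<le> D / real q + 1" using D by simp
  finally show ?thesis .
qed

text \<open>Cut greedily at \<open>n, n + q n, \<dots>\<close>; only the last, incomplete block is estimated trivially.\<close>
lemma greedy_blocks:
  fixes F :: "nat \<Rightarrow> real" and q :: "nat \<Rightarrow> nat"
  assumes q: "\<And>n. m \<le> n \<Longrightarrow> n < M \<Longrightarrow> 0 < q n \<and> q n \<le> T"
    and block: "\<And>n. m \<le> n \<Longrightarrow> n < M \<Longrightarrow> \<bar>\<Sum>j<q n. F (n + j)\<bar> \<le> C"
    and F: "\<And>n. \<bar>F n\<bar> \<le> 1"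
  shows "\<exists>B\<subseteq>{m..<M}. (\<forall>n\<in>B. \<forall>n'\<in>B. n < n' \<longrightarrow> n + q n \<le> n')
           \<and> \<bar>\<Sum>n\<in>{m..<M}. F n\<bar> \<le> C * real (card B) + real T"
  using q block
proof (induction "M - m" arbitrary: m rule: less_induct)
  case less
  show ?case
  proof (cases "m < M")
    case False
    then show ?thesis by (intro exI[of _ "{}"]) auto
  next
    case mM: True
    show ?thesis
    proof (cases "m + q m \<le> M")
      case False
      have "\<bar>\<Sum>n\<in>{m..<M}. F n\<bar> \<le> (\<Sum>n\<in>{m..<M}. 1)"
        by (rule order_trans[OF sum_abs sum_mono]) (use F in auto)
      also have "\<dots> \<le> real T" using False less.prems(1)[of m] mM by simp
      finally show ?thesis by (intro exI[of _ "{}"]) auto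
    next
      case True
      have q0: "0 < q m" using less.prems(1)[of m] mM by simp
      obtain B where B: "B \<subseteq> {m + q m..<M}"
        "\<forall>n\<in>B. \<forall>n'\<in>B. n < n' \<longrightarrow> n + q n \<le> n'"
        "\<bar>\<Sum>n\<in>{m + q m..<M}. F n\<bar> \<le> C * real (card B) + real T"
        using less.hyps[of "m + q m"] less.prems mM q0 by fastforce
      have fin: "finite B" and mB: "m \<notin> B" using B(1) q0 finite_subset by auto
      have "(\<Sum>n\<in>{m..<M}. F n) = (\<Sum>n\<in>{m..<m + q m}. F n) + (\<Sum>n\<in>{m + q m..<M}. F n)"
        using True by (simp add: sum.atLeastLessThan_concat)
      also have "(\<Sum>n\<in>{m..<m + q m}. F n) = (\<Sum>j<q m. F (m + j))"
        using sum.shift_bounds_nat_ivl[of F 0 m "q m"] by (simp add: atLeast0LessThan add.commute)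
      finally have "\<bar>\<Sum>n\<in>{m..<M}. F n\<bar> \<le> C + (C * real (card B) + real T)"
        using B(3) less.prems(2)[of m] mM by linarith
      then have "\<bar>\<Sum>n\<in>{m..<M}. F n\<bar> \<le> C * real (card (insert m B)) + real T"
        using fin mB by (simp add: algebra_simps)
      moreover have "\<forall>n\<in>insert m B. \<forall>n'\<in>insert m B. n < n' \<longrightarrow> n + q n \<le> n'"
        using B(1,2) q0 by fastforce
      moreover have "insert m B \<subseteq> {m..<M}" using B(1) mM by auto
      ultimately show ?thesis by blast
    qed
  qed
qed

section \<open>Vinogradov's estimate for sawtooth sums over a hyperbola\<close>

lemma le_twice_nat_floor:
  fixes x :: real
  assumes "x \<ge> 1"
  shows "x \<le> 2 * real (nat \<lfloor>x\<rfloor>)"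
proof -
  have "1 \<le> \<lfloor>x\<rfloor>" using assms by simp
  then have "real (nat \<lfloor>x\<rfloor>) = of_int \<lfloor>x\<rfloor>" "1 \<le> real_of_int \<lfloor>x\<rfloor>" by simp_all
  then show ?thesis by linarith
qed

text \<open>This is Taylor's formula of first order with an exact remainder; on a block the linear
  term is approximated rationally and the remainder is absorbed as a perturbation.\<close>

lemma hyperbola_expansion:
  fixes y z t :: real
  assumes "z > 0" "t \<ge> 0"
  shows "y / (z + t) = y / z - t * (y / z ^ 2) + y * t ^ 2 / (z ^ 2 * (z + t))"
proof -
  have "z + t > 0" using assms by simp
  then show ?thesis using assms
    by (simp add: divide_simps power2_eq_square) (simp add: algebra_simps)
qed

text \<open>The difference factors as y (w - z) (1/(z w^2) + 1/(z^2 w)), and both reciprocals are at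
  least 1/(2N)^3. This quantifies the monotonicity of the slope, which limits how often one fraction
  can be used.\<close>

lemma slope_difference_ge:
  fixes y z w N :: real
  assumes "0 \<le> y" "0 < z" "z \<le> w" "w \<le> 2 * N"
  shows "y * (w - z) / (4 * N ^ 3) \<le> y / z ^ 2 - y / w ^ 2"
proof -
  have w: "w > 0" and N: "N > 0" using assms by auto
  have eq: "y / z ^ 2 - y / w ^ 2 = y * (w - z) * (1 / (z * w * w) + 1 / (z * z * w))"
    using assms w by (simp add: divide_simps power2_eq_square) (simp add: algebra_simps)
  have *: "1 / (8 * N ^ 3) \<le> 1 / (a * b * c)"
    if "0 < a" "a \<le> 2 * N" "0 < b" "b \<le> 2 * N" "0 < c" "c \<le> 2 * N" for a b c
  proof -
    have "a * b * c \<le> (2 * N) * (2 * N) * (2 * N)"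
      using that by (intro mult_mono) auto
    also have "\<dots> = 8 * N ^ 3" by (simp add: power3_eq_cube)
    finally show ?thesis using that by (intro divide_left_mono mult_pos_pos) auto
  qed
  have "y * (w - z) / (4 * N ^ 3) = y * (w - z) * (1 / (8 * N ^ 3) + 1 / (8 * N ^ 3))"
    by (simp add: field_simps)
  also have "\<dots> \<le> y * (w - z) * (1 / (z * w * w) + 1 / (z * z * w))"
    using assms w by (intro mult_left_mono add_mono *) auto
  finally show ?thesis unfolding eq .
qed

text \<open>Each block contributes at most 9, so the blocks must be counted. A fraction h/k serves
  O(T^2/k^2) of them, and with slopes bounded by L there are O(k L) numerators h for each k. The
  total is O(L T^2) times a harmonic sum, and L T^2 is at most y^(1/3) by the choice of T.\<close>

lemma dyadic_sawtooth_bound: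
  fixes y \<alpha> \<beta> :: real and N m M :: nat
  assumes y: "y \<ge> 1" and \<alpha>: "0 \<le> \<alpha>" "\<alpha> \<le> 1"
    and N: "N > 0" "real N ^ 2 \<le> 4 * y" and mM: "N \<le> m" "M \<le> 2 * N"
  shows "\<bar>\<Sum>n\<in>{m..<M}. sawtooth (y / (real n + \<alpha>) - \<beta>)\<bar>
           \<le> 10600 * y powr (1/3) * (1 + ln y)"
proof -
  define w where "w = y powr (1/3)"
  have w1: "w \<ge> 1" using y by (simp add: w_def ge_one_powr_ge_zero)
  have w3: "w ^ 3 = y"
    using y by (simp add: w_def powr_powr flip: powr_realpow)
  have lny: "ln y \<ge> 0" using y by simp
  define F where "F n = sawtooth (y / (real n + \<alpha>) - \<beta>)" for n
  have F1: "\<bar>F n\<bar> \<le> 1" for n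
    using abs_sawtooth_le[of "y / (real n + \<alpha>) - \<beta>"] by (simp add: F_def)
  have w_le: "w \<le> w * (1 + ln y)" using w1 lny by (simp add: mult_le_cancel_left1)
  show ?thesis
  proof (cases "real N < w")
    case True
    have "\<bar>\<Sum>n\<in>{m..<M}. F n\<bar> \<le> (\<Sum>n\<in>{m..<M}. 1)"
      by (rule order_trans[OF sum_abs sum_mono]) (use F1 in auto)
    also have "\<dots> \<le> real N" using mM by simp
    also have "\<dots> \<le> w * (1 + ln y)" using True w_le by linarith
    also have "\<dots> \<le> 10600 * w * (1 + ln y)" using w1 lny by simp
    finally show ?thesis unfolding F_def w_def .
  next
    case False
    \<comment> \<open>The largest denominator for which the quadratic term \<open>y j\<^sup>2 / n\<^sup>3\<close>, \<open>j < q \<le> T\<close>,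
      stays below \<open>1 / q\<close>.\<close>
    define T where "T = nat \<lfloor>real N / w\<rfloor>"
    have Nw: "real N / w \<ge> 1" using False w1 by simp
    then have T0: "T > 0" unfolding T_def by linarith
    have T_le: "real T \<le> real N / w" unfolding T_def using Nw by linarith
    have T_ge: "real N / w \<le> 2 * real T" unfolding T_def by (rule le_twice_nat_floor[OF Nw])
    have "(real T) ^ 3 \<le> (real N / w) ^ 3" by (intro power_mono T_le) auto
    then have T3: "y * real T ^ 3 \<le> real N ^ 3"
      using w3 y by (simp add: power_divide pos_le_divide_eq mult.commute)
    have "(real N / w) ^ 3 \<le> (2 * real T) ^ 3" by (intro power_mono T_ge) (use w1 in auto)
    then have N3: "real N ^ 3 \<le> 8 * y * real T ^ 3"
      using w3 y by (simp add: power_divide power_mult_distrib pos_divide_le_eq mult.commute mult.left_commute)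
    \<comment> \<open>\<open>L\<close> will bound all slopes on the range. The hypothesis on
      \<open>N\<close> makes 4 L at least 1, so additive constants can later be absorbed into
      multiples of L.\<close>
    define L where "L = y / real N ^ 2"
    have L4: "1 \<le> 4 * L" using N by (simp add: L_def field_simps)
    have L0: "L > 0" using L4 by simp
    have LT: "L * real T ^ 2 \<le> w"
    proof -
      have "L * real T ^ 2 \<le> L * (real N / w) ^ 2"
        using L0 by (intro mult_left_mono power_mono T_le) auto
      also have "\<dots> = w ^ 3 / w ^ 2" using N w3 by (simp add: L_def power_divide)
      also have "\<dots> = w" using w1 by (simp add: power2_eq_square power3_eq_cube)
      finally show ?thesis .
    qed
    \<comment> \<open>This pays for the incomplete last block, whose length is at most
      \<open>T\<close>.\<close>
    have Tw: "real T \<le> 2 * w"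
    proof -
      have "real T ^ 2 \<le> (real N / w) ^ 2" by (intro power_mono T_le) auto
      also have "\<dots> \<le> 4 * w ^ 3 / w ^ 2"
        using N w3 w1 by (simp add: power_divide divide_right_mono)
      also have "\<dots> = 4 * w" using w1 by (simp add: power2_eq_square power3_eq_cube)
      also have "\<dots> \<le> (2 * w) ^ 2" using w1 by (simp add: power2_eq_square)
      finally show ?thesis by (rule power2_le_imp_le) (use w1 in auto)
    qed
    have harmT: "harm T \<le> 2 * (1 + ln y)"
    proof -
      have "real N \<le> 2 * y"
      proof (rule power2_le_imp_le)
        have "y * 1 \<le> y * y" using y by (intro mult_left_mono) auto
        then show "real N ^ 2 \<le> (2 * y) ^ 2" using N(2) by (simp add: power2_eq_square)
      qed (use y in auto)
      moreover have "real N / w \<le> real N / 1" using w1 by (intro divide_left_mono) auto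
      then have "real T \<le> real N" using T_le by simp
      ultimately have "real T \<le> 2 * y" by simp
      then have "ln (real T) \<le> ln (2 * y)" using T0 y by simp
      also have "\<dots> = ln 2 + ln y" using y by (simp add: ln_mult)
      also have "ln 2 \<le> (1::real)" using ln_2_less_1 by simp
      finally have "ln (real T) \<le> 1 + ln y" by simp
      moreover have "harm T \<le> ln (real T) + 1" 
        using euler_mascheroni_sequence_decreasing[of 1 T] T0 by (simp add: harm_def)
      ultimately show ?thesis using lny by simp
    qed
    \<comment> \<open>The derivative of y/(n + \<alpha>) is -\<open>s n\<close>; hence the
      numerators enter the block sums as \<open>- a n\<close>.\<close>
    define s where "s n = y / (real n + \<alpha>) ^ 2" for n
    have "\<exists>q a. coprime a (int q) \<and> 0 < q \<and> q \<le> T \<and> \<bar>real q * s n - of_int a\<bar> < 1 / real T" for n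
    proof -
      obtain h k where hk: "coprime h k" "0 < k" "k \<le> int T" "\<bar>of_int k * s n - of_int h\<bar> < 1 / T"
        using Dirichlet_approx_coprime[OF T0] by blast
      then show ?thesis by (intro exI[of _ "nat k"] exI[of _ h]) auto
    qed
    then obtain q a where qa: "\<And>n. coprime (a n) (int (q n))" "\<And>n. 0 < q n" "\<And>n. q n \<le> T"
        "\<And>n. \<bar>real (q n) * s n - of_int (a n)\<bar> < 1 / real T" by metis
    have block: "\<bar>\<Sum>j<q n. F (n + j)\<bar> \<le> 9" if n: "m \<le> n" "n < M" for n
    proof -
      define z where "z = real n + \<alpha>"
      have z: "z \<ge> real N" "z > 0" using n mM \<alpha> N by (auto simp: z_def)
      \<comment> \<open>\<open>e j\<close> collects, scaled by \<open>q n\<close>, the quadratic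
        remainder and the error of the rational slope. The first is at most y T^3 / N^3 and the
        second at most T * (1/T), so each is bounded by 1.\<close>
      define e where "e j = real (q n) * (y * real j ^ 2 / (z ^ 2 * (z + real j)))
        - real j * (real (q n) * s n - of_int (a n))" for j
      have e2: "\<bar>e j\<bar> \<le> 2" if j: "j < q n" for j
      proof -
        have "real (q n) * (y * real j ^ 2 / (z ^ 2 * (z + real j)))
            \<le> real T * (y * real T ^ 2 / (real N ^ 2 * real N))"
          using qa(3)[of n] j y z N by (intro mult_mono divide_mono power_mono) auto
        also have "\<dots> = y * real T ^ 3 / real N ^ 3" by (simp add: power2_eq_square power3_eq_cube)
        also have "\<dots> \<le> 1" using T3 N by simp
        finally have 1: "real (q n) * (y * real j ^ 2 / (z ^ 2 * (z + real j))) \<le> 1" .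
        have 2: "0 \<le> real (q n) * (y * real j ^ 2 / (z ^ 2 * (z + real j)))"
          using y z by simp
        have "\<bar>real j * (real (q n) * s n - of_int (a n))\<bar> \<le> real T * (1 / real T)"
          unfolding abs_mult using qa(3)[of n] qa(4)[of n] j by (intro mult_mono) auto
        then have 3: "\<bar>real j * (real (q n) * s n - of_int (a n))\<bar> \<le> 1" using T0 by simp
        show ?thesis using 1 2 3 unfolding e_def by linarith
      qed
      have "F (n + j) = sawtooth ((y / z - \<beta>) + (of_int (- a n) * real j + e j) / real (q n))" for j
      proof -
        have "y / (real (n + j) + \<alpha>) = y / (z + real j)" by (simp add: z_def add_ac)
        also have "\<dots> = y / z - real j * s n + y * real j ^ 2 / (z ^ 2 * (z + real j))"
          using hyperbola_expansion[of z "real j" y] z by (simp add: s_def z_def)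
        also have "\<dots> = y / z + (of_int (- a n) * real j + e j) / real (q n)"
          using qa(2)[of n] by (simp add: e_def field_simps del: of_int_minus)
        finally show ?thesis by (simp add: F_def algebra_simps)
      qed
      then show ?thesis
        using sum_sawtooth_rational_slope[of "q n" "- a n" e "y / z - \<beta>"] qa(1,2)[of n] e2 by simp
    qed
    obtain B where B: "B \<subseteq> {m..<M}" "\<forall>n\<in>B. \<forall>n'\<in>B. n < n' \<longrightarrow> n + q n \<le> n'"
        "\<bar>\<Sum>n\<in>{m..<M}. F n\<bar> \<le> 9 * real (card B) + real T"
      using greedy_blocks[of m M q T F 9] qa block F1 by blast
    have finB: "finite B" using B(1) finite_subset by auto
    \<comment> \<open>The range is half-open, so n is at most 2 N - 1 and adding \<alpha> stays
      within 2 N.\<close>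
    have zB: "real N \<le> real n + \<alpha>" "real n + \<alpha> \<le> 2 * real N" if "n \<in> B" for n
      using that B(1) mM \<alpha> by fastforce+
    \<comment> \<open>All pairs (denominator, numerator) that can occur: the slope lies in [0, L]
      and the approximation error is below 1/T, hence below 1.\<close>
    define P where "P = Sigma {1..T} (\<lambda>k. {0..\<lfloor>real k * L\<rfloor> + 1})"
    have PB: "(\<lambda>n. (q n, a n)) ` B \<subseteq> P"
    proof safe
      fix n assume n: "n \<in> B"
      have T1: "1 / real T \<le> 1" using T0 by simp
      have z0: "real n + \<alpha> > 0" using zB[OF n] N by linarith
      have "0 \<le> s n" using y by (simp add: s_def)
      then have "0 \<le> real (q n) * s n" by simp
      then have "of_int (a n) > (-1 :: real)" using qa(4)[of n] T1 by linarith
      moreover have "s n \<le> L" unfolding s_def L_def using y zB[OF n] N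
        by (intro divide_left_mono power_mono mult_pos_pos zero_less_power) auto
      then have "real (q n) * s n \<le> real (q n) * L" by (intro mult_left_mono) auto
      then have "of_int (a n) \<le> real (q n) * L + 1" using qa(4)[of n] T1 by linarith
      then have "a n \<le> \<lfloor>real (q n) * L\<rfloor> + 1" by linarith
      ultimately show "(q n, a n) \<in> P" using qa(2,3)[of n] by (auto simp: P_def)
    qed
    have finP: "finite P" by (simp add: P_def)
    \<comment> \<open>Two blocks with the same h/k have slopes within 2/(k T), which forces their
      starts within 64 T^2 / k; being of length k, they are also k apart. The extra 1 from the
      spacing count is at most T^2/k^2, giving 64 + 1.\<close>
    have fiber: "real (card {n\<in>B. (q n, a n) = (k, h)}) \<le> 65 * real T ^ 2 / real k ^ 2"
      if k: "0 < k" "k \<le> T" for k h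
    proof -
      have "real (card {n\<in>B. (q n, a n) = (k, h)}) \<le> (64 * real T ^ 2 / real k) / real k + 1"
      proof (rule card_le_of_spacing)
        fix n n' assume nn: "n \<in> {n \<in> B. (q n, a n) = (k, h)}" "n' \<in> {n \<in> B. (q n, a n) = (k, h)}" "n < n'"
        show "n + k \<le> n'" using B(2) nn by auto
        have "\<bar>real k * s n - of_int h\<bar> < 1 / real T" "\<bar>real k * s n' - of_int h\<bar> < 1 / real T"
          using nn qa(4)[of n] qa(4)[of n'] by auto
        then have "real k * s n - real k * s n' \<le> 2 / real T" by linarith
        then have "real k * (s n - s n') \<le> 2 / real T" by (simp add: algebra_simps)
        moreover have "real k * (y * (real n' - real n) / (4 * real N ^ 3)) \<le> real k * (s n - s n')"
          using slope_difference_ge[of y "real n + \<alpha>" "real n' + \<alpha>" "real N"] y N zB[of n] zB[of n'] nn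
          unfolding s_def by (intro mult_left_mono) auto
        ultimately have "real k * (y * (real n' - real n) / (4 * real N ^ 3)) \<le> 2 / real T" by linarith
        then have "real k * y * real T * (real n' - real n) \<le> 8 * real N ^ 3"
          using T0 N by (simp add: field_simps)
        also have "\<dots> \<le> 64 * y * real T ^ 3" using N3 by simp
        finally have "y * real T * (real k * (real n' - real n)) \<le> y * real T * (64 * real T ^ 2)"
          by (simp add: power2_eq_square power3_eq_cube algebra_simps)
        then have "real k * (real n' - real n) \<le> 64 * real T ^ 2"
          using y T0 by (simp add: mult_le_cancel_left_pos)
        then show "real n' - real n \<le> 64 * real T ^ 2 / real k" using k by (simp add: field_simps)
      qed (use finB k in auto)
      also have "(64 * real T ^ 2 / real k) / real k = 64 * real T ^ 2 / real k ^ 2"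
        by (simp add: power2_eq_square)
      also have "1 \<le> real T ^ 2 / real k ^ 2" using k by (simp add: power_mono)
      finally show ?thesis by simp
    qed
    have "real (card B) = (\<Sum>n\<in>B. 1)" by simp
    also have "\<dots> = (\<Sum>p\<in>P. \<Sum>n\<in>{n\<in>B. (q n, a n) = p}. 1)"
      by (rule sum.group[OF finB finP PB, symmetric])
    also have "\<dots> = (\<Sum>p\<in>P. real (card {n\<in>B. (q n, a n) = p}))" by simp
    also have "\<dots> = (\<Sum>k\<in>{1..T}. \<Sum>h\<in>{0..\<lfloor>real k * L\<rfloor> + 1}. real (card {n\<in>B. (q n, a n) = (k, h)}))"
      unfolding P_def by (subst sum.Sigma) (auto intro!: sum.cong)
    also have "\<dots> \<le> (\<Sum>k\<in>{1..T}. \<Sum>h\<in>{0..\<lfloor>real k * L\<rfloor> + 1}. 65 * real T ^ 2 / real k ^ 2)"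
      by (intro sum_mono fiber) auto
    \<comment> \<open>Each k has at most k L + 2 numerators, and 1 \<le> 4 k L turns this into 9 k
      L; 585 is 9 * 65.\<close>
    also have "\<dots> \<le> (\<Sum>k\<in>{1..T}. 585 * (L * real T ^ 2) * (1 / real k))"
    proof (rule sum_mono)
      fix k assume k: "k \<in> {1..T}"
      have kL: "1 \<le> 4 * (real k * L)" using L4 k mult_mono[of 1 "real k" 1 "4 * L"] by (simp add: mult.left_commute)
      have "real (nat (\<lfloor>real k * L\<rfloor> + 2)) \<le> real k * L + 2" using kL by linarith
      also have "\<dots> \<le> 9 * (real k * L)" using kL by linarith
      finally have "real (nat (\<lfloor>real k * L\<rfloor> + 2)) * (65 * real T ^ 2 / real k ^ 2)
          \<le> 9 * (real k * L) * (65 * real T ^ 2 / real k ^ 2)"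
        by (intro mult_right_mono) auto
      also have "\<dots> = 585 * (L * real T ^ 2) * (1 / real k)"
        using k by (simp add: power2_eq_square)
      finally show "(\<Sum>h\<in>{0..\<lfloor>real k * L\<rfloor> + 1}. 65 * real T ^ 2 / real k ^ 2)
          \<le> 585 * (L * real T ^ 2) * (1 / real k)" by (simp add: add.commute)
    qed
    also have "\<dots> = 585 * (L * real T ^ 2) * harm T"
      by (simp add: harm_def sum_distrib_left inverse_eq_divide)
    also have "\<dots> \<le> 585 * w * (2 * (1 + ln y))"
      using LT L0 harmT w1 by (intro mult_mono) (auto simp: harm_nonneg)
    finally have "real (card B) \<le> 1170 * (w * (1 + ln y))" by (simp add: algebra_simps)
    then have "\<bar>\<Sum>n\<in>{m..<M}. F n\<bar> \<le> 9 * (1170 * (w * (1 + ln y))) + 2 * (w * (1 + ln y))"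
      using B(3) Tw w_le by linarith
    also have "\<dots> \<le> 10600 * w * (1 + ln y)" using w1 lny by simp
    finally show ?thesis unfolding F_def w_def .
  qed
qed

text \<open>Repeated halving of the upper end splits the range into O(1 + ln y) dyadic pieces, which
  costs the second logarithm.\<close>

lemma sawtooth_sum_bound:
  fixes y \<alpha> \<beta> :: real and N :: nat
  assumes y: "y \<ge> 1" and \<alpha>: "0 \<le> \<alpha>" "\<alpha> \<le> 1" and N: "real N ^ 2 \<le> 4 * y"
  shows "\<bar>\<Sum>n\<in>{1..N}. sawtooth (y / (real n + \<alpha>) - \<beta>)\<bar>
           \<le> 31800 * y powr (1/3) * (1 + ln y) ^ 2"
proof (cases "N = 0")
  case True
  then show ?thesis by simp
next
  case False
  define D where "D = 10600 * y powr (1/3) * (1 + ln y)"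
  have lny: "ln y \<ge> 0" using y by simp
  have D0: "D \<ge> 0" using lny by (simp add: D_def)
  define F where "F n = sawtooth (y / (real n + \<alpha>) - \<beta>)" for n
  have dyadic: "\<bar>\<Sum>n\<in>{1..<M}. F n\<bar> \<le> real k * D" if "M \<le> 2 ^ k" "M \<le> Suc N" for k M
    using that
  proof (induction k arbitrary: M)
    case 0
    then show ?case by simp
  next
    case (Suc k)
    show ?case
    proof (cases "M \<le> 1")
      case True
      then show ?thesis using D0 by simp
    next
      case False
      \<comment> \<open>Rounding the half upwards ensures M \<le> 2 P, so that [P, M) is an
        admissible dyadic piece.\<close>
      define P where "P = (M + 1) div 2"
      have P: "0 < P" "P < M" "M \<le> 2 * P" "P \<le> 2 ^ k" "P \<le> N"
        using False Suc.prems by (auto simp: P_def)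
      have "real P ^ 2 \<le> real N ^ 2" using P by (intro power_mono) auto
      then have "real P ^ 2 \<le> 4 * y" using N by linarith
      then have "\<bar>\<Sum>n\<in>{P..<M}. F n\<bar> \<le> D"
        unfolding F_def D_def using dyadic_sawtooth_bound[OF y \<alpha> P(1) _ order.refl P(3)] by blast
      moreover have "\<bar>\<Sum>n\<in>{1..<P}. F n\<bar> \<le> real k * D"
        using Suc.IH[of P] P by simp
      moreover have "(\<Sum>n\<in>{1..<M}. F n) = (\<Sum>n\<in>{1..<P}. F n) + (\<Sum>n\<in>{P..<M}. F n)"
        using P by (simp add: sum.atLeastLessThan_concat)
      ultimately show ?thesis by (simp add: distrib_right)
    qed
  qed
  obtain k where k: "2 ^ k \<le> N" "N < 2 ^ (k + 1)"
    using ex_power_ivl1[of 2 N] False by auto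
  have "real k * (1 / 2) \<le> real k * ln 2"
    using ln2_ge_two_thirds by (intro mult_left_mono) auto
  also have "\<dots> = ln (2 ^ k)" by (simp add: ln_realpow)
  also have "\<dots> \<le> ln (2 * y)"
  proof -
    have "real N \<le> 2 * y"
    proof (rule power2_le_imp_le)
      have "y * 1 \<le> y * y" using y by (intro mult_left_mono) auto
      then show "real N ^ 2 \<le> (2 * y) ^ 2" using N by (simp add: power2_eq_square)
    qed (use y in auto)
    moreover have "real (2 ^ k) \<le> real N" using k(1) by (simp only: of_nat_le_iff)
    ultimately have "real (2 ^ k) \<le> 2 * y" by (rule order.trans[rotated])
    then have "2 ^ k \<le> 2 * y" by simp
    then show ?thesis using y by (subst ln_le_cancel_iff) auto
  qed
  also have "\<dots> = ln 2 + ln y" using y by (simp add: ln_mult)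
  also have "\<dots> \<le> 1 + ln y" using ln_2_less_1 by simp
  finally have k_le: "real (k + 1) \<le> 3 * (1 + ln y)" using lny by simp
  have "\<bar>\<Sum>n\<in>{1..<Suc N}. F n\<bar> \<le> real (k + 1) * D" using k by (intro dyadic) auto
  also have "\<dots> \<le> 3 * (1 + ln y) * D" using k_le D0 by (rule mult_right_mono)
  also have "\<dots> = 31800 * y powr (1/3) * (1 + ln y) ^ 2" unfolding D_def by algebra
  finally show ?thesis by (simp add: F_def atLeastLessThanSuc_atLeastAtMost)
qed

section \<open>Counting the n for which d divides [x/n]\<close>

text \<open>With m = [t], the difference [t/d] - [(t-1)/d] equals [m/d] - [(m-1)/d], which is 1
  exactly when d divides m. Replacing each floor by its argument minus the fractional part gives the
  formula.\<close>

lemma of_bool_dvd_floor: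
  fixes t :: real and d :: nat
  assumes "d > 0" "t \<ge> 0"
  shows "of_bool (d dvd nat \<lfloor>t\<rfloor>) = 1 / real d - sawtooth (t / real d) + sawtooth (t / real d - 1 / real d)"
proof -
  define m where "m = \<lfloor>t\<rfloor>"
  have "\<lfloor>t / real d\<rfloor> = m div int d"
    using floor_divide_real_eq_div[of "int d" t] by (simp add: m_def)
  moreover have "\<lfloor>t / real d - 1 / real d\<rfloor> = (m - 1) div int d"
    using floor_divide_real_eq_div[of "int d" "t - 1"] by (simp add: m_def diff_divide_distrib)
  moreover have "m div int d - (m - 1) div int d = of_bool (int d dvd m)"
  proof (cases "int d dvd m")
    case True
    then obtain k where "m = int d * k" ..
    moreover have "(int d * k - 1) div int d = k - 1"
      by (rule int_div_pos_eq[of _ _ _ "int d - 1"]) (use assms in \<open>auto simp: algebra_simps\<close>)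
    ultimately show ?thesis using assms by simp
  next
    case False
    define r where "r = m mod int d"
    have "r \<noteq> 0" "0 \<le> r" "r < int d" using False assms by (auto simp: r_def dvd_eq_mod_eq_0)
    moreover have "m = int d * (m div int d) + r" by (simp add: r_def)
    ultimately have "(m - 1) div int d = m div int d"
      by (intro int_div_pos_eq[of _ _ _ "r - 1"]) auto
    then show ?thesis using False by simp
  qed
  moreover have "int d dvd m \<longleftrightarrow> d dvd nat \<lfloor>t\<rfloor>"
    using assms(2) by (simp add: m_def flip: int_dvd_int_iff)
  ultimately have "\<lfloor>t / real d\<rfloor> - \<lfloor>t / real d - 1 / real d\<rfloor> = of_bool (d dvd nat \<lfloor>t\<rfloor>)"
    by simp
  then have "real_of_int \<lfloor>t / real d\<rfloor> - of_int \<lfloor>t / real d - 1 / real d\<rfloor> = of_bool (d dvd nat \<lfloor>t\<rfloor>)"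
    by (metis of_int_diff of_int_of_bool)
  then show ?thesis by (simp add: sawtooth_def frac_def)
qed

text \<open>The term of index n + A lies between 1/((n+c)(n+c+1)) for c = A + 1 and for c = A; both
  comparison series telescope, with sum 1/c.\<close>

lemma tail_sum_bounds:
  fixes \<alpha> :: real and A :: nat
  assumes \<alpha>: "0 \<le> \<alpha>" "\<alpha> \<le> 1" and A: "A > 0"
  defines "u \<equiv> \<lambda>k. 1 / (real (Suc k) * (real (Suc k) + \<alpha>))"
  shows "summable u" and "1 / (real A + 1) \<le> suminf u - (\<Sum>k<A. u k)"
    and "suminf u - (\<Sum>k<A. u k) \<le> 1 / real A"
proof -
  define f where "f c n = 1 / (real n + c)" for c :: real and n :: nat
  have tel: "(\<lambda>n. f c n - f c (Suc n)) sums (1 / c)" for c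
  proof -
    have "f c \<longlonglongrightarrow> 0" unfolding f_def by real_asymp
    from telescope_sums'[OF this] show ?thesis by (simp add: f_def)
  qed
  have diff: "f c n - f c (Suc n) = 1 / ((real n + c) * (real n + c + 1))" if "c > 0" for c n
    using that by (simp add: f_def divide_simps)
  have upper: "u (n + A) \<le> f (real A) n - f (real A) (Suc n)" for n
    unfolding diff[of "real A" n, OF of_nat_0_less_iff[THEN iffD2, OF A]] u_def
    using A \<alpha> by (intro divide_left_mono mult_mono mult_pos_pos) (auto simp: algebra_simps)
  have lower: "f (real A + 1) n - f (real A + 1) (Suc n) \<le> u (n + A)" for n
  proof -
    have "f (real A + 1) n - f (real A + 1) (Suc n)
        = 1 / ((real n + (real A + 1)) * (real n + (real A + 1) + 1))"
      by (rule diff) simp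
    also have "\<dots> \<le> u (n + A)" unfolding u_def
      using A \<alpha> by (intro divide_left_mono mult_mono mult_pos_pos) (auto simp: algebra_simps)
    finally show ?thesis .
  qed
  have u0: "u n \<ge> 0" for n using \<alpha> by (simp add: u_def)
  have sumA: "summable (\<lambda>n. u (n + A))"
    by (rule summable_comparison_test'[OF sums_summable[OF tel[of "real A"]]])
       (use upper u0 in auto)
  then show su: "summable u" by (simp add: summable_iff_shift)
  have eq: "suminf u - (\<Sum>k<A. u k) = (\<Sum>n. u (n + A))"
    using suminf_split_initial_segment[OF su, of A] by simp
  show "1 / (real A + 1) \<le> suminf u - (\<Sum>k<A. u k)"
    unfolding eq sums_unique[OF tel] by (intro suminf_le lower sumA sums_summable[OF tel])
  show "suminf u - (\<Sum>k<A. u k) \<le> 1 / real A"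
    unfolding eq sums_unique[OF tel] by (intro suminf_le upper sumA sums_summable[OF tel])
qed

text \<open>Since l is at least 1, the n in question are exactly the integers in (x/(l+1),
  x/l].\<close>

lemma card_floor_eq:
  fixes x :: real and l :: nat
  assumes "x \<ge> 0" "l > 0"
  shows "real (card {n\<in>{1..nat \<lfloor>x\<rfloor>}. nat \<lfloor>x / real n\<rfloor> = l})
           = of_int \<lfloor>x / real l\<rfloor> - of_int \<lfloor>x / (real l + 1)\<rfloor>"
proof -
  have "{n\<in>{1..nat \<lfloor>x\<rfloor>}. nat \<lfloor>x / real n\<rfloor> = l} = {nat \<lfloor>x / (real l + 1)\<rfloor><..nat \<lfloor>x / real l\<rfloor>}"
  proof (intro set_eqI)
    fix n :: nat
    have "(n \<in> {n\<in>{1..nat \<lfloor>x\<rfloor>}. nat \<lfloor>x / real n\<rfloor> = l})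
        \<longleftrightarrow> n > 0 \<and> real n \<le> x \<and> real l \<le> x / real n \<and> x / real n < real l + 1"
      using assms by (auto simp: le_nat_iff le_floor_iff nat_eq_iff floor_eq_iff)
    also have "\<dots> \<longleftrightarrow> n > 0 \<and> real n \<le> x \<and> real l * real n \<le> x \<and> x < (real l + 1) * real n"
      by (auto simp: field_simps)
    also have "\<dots> \<longleftrightarrow> real l * real n \<le> x \<and> x < (real l + 1) * real n"
    proof -
      have "n > 0" if "x < (real l + 1) * real n" using that assms(1) by (cases n) auto
      moreover have "real n \<le> x" if "real l * real n \<le> x"
        using that assms(2) mult_right_mono[of 1 "real l" "real n"] by simp
      ultimately show ?thesis by blast
    qed
    also have "\<dots> \<longleftrightarrow> n \<in> {nat \<lfloor>x / (real l + 1)\<rfloor><..nat \<lfloor>x / real l\<rfloor>}"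
    proof -
      have "real l * real n \<le> x \<longleftrightarrow> n \<le> nat \<lfloor>x / real l\<rfloor>"
        using assms by (simp add: le_nat_iff le_floor_iff pos_le_divide_eq mult.commute)
      moreover have "x < (real l + 1) * real n \<longleftrightarrow> nat \<lfloor>x / (real l + 1)\<rfloor> < n"
        using assms by (simp add: nat_less_iff floor_less_iff pos_divide_less_eq mult.commute)
      ultimately show ?thesis by auto
    qed
    finally show "(n \<in> {n\<in>{1..nat \<lfloor>x\<rfloor>}. nat \<lfloor>x / real n\<rfloor> = l})
      \<longleftrightarrow> n \<in> {nat \<lfloor>x / (real l + 1)\<rfloor><..nat \<lfloor>x / real l\<rfloor>}" .
  qed
  moreover have "\<lfloor>x / (real l + 1)\<rfloor> \<le> \<lfloor>x / real l\<rfloor>"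
    using assms by (intro floor_mono divide_left_mono) auto
  ultimately show ?thesis using assms by (simp add: of_nat_diff nat_mono)
qed

text \<open>Dirichlet's hyperbola method: pairs (n, k) with [x/n] = d k satisfy n k \<le> y, so n or
  k is at most A = [sqrt y]. Rows n \<le> A are treated by the indicator formula, columns k \<le> A
  by counting n in an interval.\<close>

lemma count_divisible_quotients:
  fixes x :: real and d :: nat
  assumes d: "d > 0" and dx: "real d \<le> x"
  shows "\<bar>(\<Sum>n\<in>{1..nat \<lfloor>x\<rfloor>}. of_bool (d dvd nat \<lfloor>x / real n\<rfloor>))
            - x * (\<Sum>k. 1 / (real (d * Suc k) * (real (d * Suc k) + 1)))\<bar>
         \<le> 127204 * x powr (1/3) * (1 + ln x) ^ 2"
proof -
  define y where "y = x / real d"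
  define \<alpha> where "\<alpha> = 1 / real d"
  define X where "X = nat \<lfloor>x\<rfloor>"
  define A where "A = nat \<lfloor>sqrt y\<rfloor>"
  define G where "G n = nat \<lfloor>x / real n\<rfloor>" for n :: nat
  have x1: "x \<ge> 1" using d dx by linarith
  have y1: "y \<ge> 1" using d dx by (simp add: y_def)
  have \<alpha>: "0 \<le> \<alpha>" "\<alpha> \<le> 1" "0 < \<alpha>" using d by (auto simp: \<alpha>_def)
  have yx: "y \<le> x" unfolding y_def using d x1 by (simp add: divide_le_eq mult_le_cancel_left1)
  have sq1: "1 \<le> sqrt y" using y1 by simp
  have A0: "A > 0" unfolding A_def using sq1 by linarith
  have A_le: "real A \<le> sqrt y" unfolding A_def using sq1 by linarith
  have A_gt: "sqrt y < real A + 1" unfolding A_def using sq1 by linarith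
  have A2: "real A ^ 2 \<le> y" using power_mono[OF A_le, of 2] y1 by simp
  have A1: "y < (real A + 1) ^ 2" using power_strict_mono[OF A_gt, of 2] y1 by simp
  have AX: "A \<le> X"
  proof -
    have "real A * 1 \<le> real A * real A" using A0 by (intro mult_left_mono) auto
    then have "real A \<le> x" using A2 yx by (simp add: power2_eq_square)
    then show ?thesis by (simp add: X_def le_nat_floor)
  qed
  have saw: "\<bar>\<Sum>n\<in>{1..A}. sawtooth (y / (real n + a) - b)\<bar>
      \<le> 31800 * y powr (1/3) * (1 + ln y) ^ 2" if "0 \<le> a" "a \<le> 1" for a b
    using sawtooth_sum_bound[OF y1 that, of A b] A2 y1 by simp

  have small: "(\<Sum>n\<in>{1..A}. of_bool (d dvd G n))
      = real A * \<alpha> - (\<Sum>n\<in>{1..A}. sawtooth (y / (real n + 0) - 0))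
          + (\<Sum>n\<in>{1..A}. sawtooth (y / (real n + 0) - \<alpha>))"
  proof -
    have "of_bool (d dvd G n) = \<alpha> - sawtooth (y / (real n + 0) - 0) + sawtooth (y / (real n + 0) - \<alpha>)" for n
      using of_bool_dvd_floor[OF d, of "x / real n"] x1
      by (simp add: G_def \<alpha>_def y_def divide_divide_eq_left mult.commute)
    then show ?thesis by (simp only: sum.distrib sum_subtractf sum_constant card_atLeastAtMost) simp
  qed

  \<comment> \<open>\<open>v n\<close> records the contribution of the columns k \<le> A to row n.
    Summing over all n first gives interval counts; beyond A it coincides with the wanted indicator,
    because n k \<le> y < (A+1)^2 rules out k > A.\<close>
  define v where "v n = (\<Sum>k\<in>{1..A}. of_bool (G n = d * k) :: real)" for n
  have v_total: "(\<Sum>n\<in>{1..X}. v n)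
      = y * \<alpha> * (\<Sum>k<A. 1 / (real (Suc k) * (real (Suc k) + \<alpha>)))
          - (\<Sum>k\<in>{1..A}. sawtooth (y / (real k + 0) - 0))
          + (\<Sum>k\<in>{1..A}. sawtooth (y / (real k + \<alpha>) - 0))"
  proof -
    have "(\<Sum>n\<in>{1..X}. v n) = (\<Sum>k\<in>{1..A}. \<Sum>n\<in>{1..X}. of_bool (G n = d * k))"
      unfolding v_def by (rule sum.swap)
    also have "\<dots> = (\<Sum>k\<in>{1..A}. y * \<alpha> * (1 / (real k * (real k + \<alpha>)))
        - sawtooth (y / (real k + 0) - 0) + sawtooth (y / (real k + \<alpha>) - 0))"
    proof (rule sum.cong)
      fix k assume k: "k \<in> {1..A}"
      have 1: "x / real (d * k) = y / real k" by (simp add: y_def)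
      have "real (d * k) + 1 = real d * (real k + \<alpha>)" using d by (simp add: \<alpha>_def distrib_left)
      then have 2: "x / (real (d * k) + 1) = y / (real k + \<alpha>)" by (simp add: y_def)
      have "(\<Sum>n\<in>{1..X}. of_bool (G n = d * k)) = real (card {n\<in>{1..X}. G n = d * k})"
        by (simp add: sum.If_cases of_bool_def Int_def)
      also have "\<dots> = of_int \<lfloor>y / real k\<rfloor> - of_int \<lfloor>y / (real k + \<alpha>)\<rfloor>"
        unfolding X_def G_def using card_floor_eq[of x "d * k"] x1 d k 1 2 by simp
      also have "\<dots> = (y / real k - y / (real k + \<alpha>)) - sawtooth (y / real k) + sawtooth (y / (real k + \<alpha>))"
        by (simp add: sawtooth_def frac_def)
      also have "y / real k - y / (real k + \<alpha>) = y * \<alpha> * (1 / (real k * (real k + \<alpha>)))"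
        using k \<alpha> by (simp add: divide_simps) (simp add: algebra_simps)
      finally show "(\<Sum>n\<in>{1..X}. of_bool (G n = d * k)) = y * \<alpha> * (1 / (real k * (real k + \<alpha>)))
        - sawtooth (y / (real k + 0) - 0) + sawtooth (y / (real k + \<alpha>) - 0)" by simp
    qed simp
    also have "\<dots> = y * \<alpha> * (\<Sum>k\<in>{1..A}. 1 / (real k * (real k + \<alpha>)))
          - (\<Sum>k\<in>{1..A}. sawtooth (y / (real k + 0) - 0))
          + (\<Sum>k\<in>{1..A}. sawtooth (y / (real k + \<alpha>) - 0))"
      by (simp only: sum.distrib sum_subtractf sum_distrib_left)
    also have "(\<Sum>k\<in>{1..A}. 1 / (real k * (real k + \<alpha>))) = (\<Sum>k<A. 1 / (real (Suc k) * (real (Suc k) + \<alpha>)))"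
      by (rule sum.reindex_bij_witness[of _ Suc "\<lambda>k. k - 1"]) auto
    finally show ?thesis .
  qed

  have large: "of_bool (d dvd G n) = v n" if n: "n \<in> {A+1..X}" for n
  proof -
    have nx: "real n \<le> x" using n x1 by (auto simp: X_def le_nat_iff le_floor_iff)
    have n0: "n > 0" using n by simp
    then have G1: "1 \<le> G n" using nx by (simp add: G_def le_nat_iff le_floor_iff)
    have "k \<in> {1..A}" if "G n = d * k" for k
    proof -
      have "k \<noteq> 0" using that G1 by auto
      have "real (G n) \<le> x / real n" unfolding G_def using x1 n0 by simp
      then have "real d * real k * real n \<le> x" using that n0 by (simp add: pos_le_divide_eq)
      then have kn: "real k * real n \<le> y" using d by (simp add: y_def pos_le_divide_eq mult_ac)
      have "k \<le> A"
      proof (rule ccontr)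
        assume "\<not> k \<le> A"
        then have "(real A + 1) * (real A + 1) \<le> real k * real n"
          using n by (intro mult_mono) auto
        then show False using kn A1 by (simp add: power2_eq_square)
      qed
      then show ?thesis using \<open>k \<noteq> 0\<close> by simp
    qed
    then have eq: "{k\<in>{1..A}. G n = d * k} = (if d dvd G n then {G n div d} else {})"
      using d by (auto simp: dvd_def)
    have "v n = real (card {k\<in>{1..A}. G n = d * k})"
      by (simp add: v_def sum.If_cases of_bool_def Int_def)
    then show ?thesis unfolding eq by simp
  qed

  \<comment> \<open>The columns \<open>k \<le> A\<close> also count lattice points with \<open>n \<le> A\<close>, but at most the corner of the square.\<close>
  have corner: "n = A \<and> k = A" if "G n = d * k" "n \<in> {1..A}" "k \<in> {1..A}" for n k
  proof (rule ccontr)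
    assume ne: "\<not> (n = A \<and> k = A)"
    have "x / real n < real (G n) + 1" unfolding G_def using x1 by linarith
    then have "x < (real d * real k + 1) * real n"
      using that by (simp add: pos_divide_less_eq)
    then have "y < real n * (real k + \<alpha>)"
      using d by (simp add: y_def \<alpha>_def pos_divide_less_eq field_simps)
    also have "\<dots> \<le> real A * real A"
    proof (cases "k = A")
      case True
      then have "real n * (real k + \<alpha>) \<le> (real A - 1) * (real A + 1)"
        using that ne \<alpha> by (intro mult_mono) auto
      then show ?thesis by (simp add: algebra_simps)
    next
      case False
      then have "real k + 1 \<le> real A" using that by simp
      then show ?thesis using that \<alpha> by (intro mult_mono) auto
    qed
    finally show False using A2 by (simp add: power2_eq_square)
  qed
  have v_corner: "0 \<le> (\<Sum>n\<in>{1..A}. v n)" "(\<Sum>n\<in>{1..A}. v n) \<le> 1"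
  proof -
    show "0 \<le> (\<Sum>n\<in>{1..A}. v n)" by (auto simp: v_def intro!: sum_nonneg)
    have "(\<Sum>n\<in>{1..A}. v n) \<le> (\<Sum>n\<in>{1..A}. \<Sum>k\<in>{1..A}. of_bool (n = A) * of_bool (k = A))"
      unfolding v_def using corner by (intro sum_mono) auto
    also have "\<dots> = (\<Sum>n\<in>{1..A}. of_bool (n = A)) * (\<Sum>k\<in>{1..A}. of_bool (k = A))"
      by (simp only: sum_product)
    also have "(\<Sum>k\<in>{1..A}. of_bool (k = A)) = (1 :: real)" using A0 by (simp add: of_bool_def)
    finally show "(\<Sum>n\<in>{1..A}. v n) \<le> 1" by simp
  qed

  have split: "(\<Sum>n\<in>{1..X}. f n) = (\<Sum>n\<in>{1..A}. f n) + (\<Sum>n\<in>{A+1..X}. f n)" for f :: "nat \<Rightarrow> real"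
    using AX by (subst sum.union_disjoint[symmetric]) (auto intro!: sum.cong)
  have total: "(\<Sum>n\<in>{1..X}. of_bool (d dvd G n))
      = (\<Sum>n\<in>{1..A}. of_bool (d dvd G n)) + (\<Sum>n\<in>{1..X}. v n) - (\<Sum>n\<in>{1..A}. v n)"
    using split[of v] split[of "\<lambda>n. of_bool (d dvd G n)"] large by simp

  define u where "u k = 1 / (real (Suc k) * (real (Suc k) + \<alpha>))" for k
  note tail = tail_sum_bounds[OF \<alpha>(1,2) A0, folded u_def]
  have series: "x * (\<Sum>k. 1 / (real (d * Suc k) * (real (d * Suc k) + 1))) = y * \<alpha> * suminf u"
  proof -
    have "1 / (real (d * Suc k) * (real (d * Suc k) + 1)) = \<alpha> ^ 2 * u k" for k
    proof -
      have "real (d * Suc k) + 1 = real d * (real (Suc k) + \<alpha>)"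
        using d by (simp add: \<alpha>_def distrib_left del: of_nat_Suc mult_Suc_right)
      then show ?thesis
        unfolding u_def by (simp add: \<alpha>_def power2_eq_square mult_ac del: of_nat_Suc mult_Suc_right)
    qed
    then have "(\<Sum>k. 1 / (real (d * Suc k) * (real (d * Suc k) + 1))) = \<alpha> ^ 2 * suminf u"
      using suminf_mult[OF tail(1)] by simp
    then show ?thesis by (simp add: y_def \<alpha>_def power2_eq_square)
  qed
  \<comment> \<open>The columns yield only the first A terms of the series. The missing tail is
    about y \<alpha> / A, hence about A \<alpha>, which is the main term of the rows n \<le>
    A.\<close>
  have tail_close: "\<bar>y * \<alpha> * (suminf u - (\<Sum>k<A. u k)) - real A * \<alpha>\<bar> \<le> 3"
  proof -
    define E where "E = suminf u - (\<Sum>k<A. u k)"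
    have "real A - 1 \<le> real A ^ 2 / (real A + 1)"
    proof -
      have "(real A - 1) * (real A + 1) \<le> real A ^ 2"
        by (simp add: power2_eq_square algebra_simps)
      then show ?thesis by (simp add: pos_le_divide_eq)
    qed
    also have "\<dots> \<le> y * (1 / (real A + 1))" using A2 by (simp add: divide_right_mono)
    also have "\<dots> \<le> y * E" unfolding E_def using tail(2) y1 by (intro mult_left_mono) auto
    finally have 1: "real A - 1 \<le> y * E" .
    have "y * E \<le> y * (1 / real A)" unfolding E_def using tail(3) y1 by (intro mult_left_mono) auto
    also have "\<dots> \<le> (real A + 1) ^ 2 / real A" using A1 by (simp add: divide_right_mono)
    also have "\<dots> \<le> real A + 3"
      using A0 by (simp add: pos_divide_le_eq power2_eq_square algebra_simps)
    finally have "\<bar>y * E - real A\<bar> \<le> 3" using 1 by linarith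
    then have "\<alpha> * \<bar>y * E - real A\<bar> \<le> 1 * 3" using \<alpha> by (intro mult_mono) auto
    then have "\<bar>\<alpha> * (y * E - real A)\<bar> \<le> 3" using \<alpha> by (simp add: abs_mult)
    then show ?thesis by (simp add: E_def algebra_simps)
  qed
  define D where "D = 31800 * y powr (1/3) * (1 + ln y) ^ 2"
  \<comment> \<open>The plain sawtooth sum occurs in both rows and columns, so three bounds are
    applied four times. The constant 4 is 3 from the tail and 1 from the corner.\<close>
  have "\<bar>(\<Sum>n\<in>{1..X}. of_bool (d dvd G n)) - y * \<alpha> * suminf u\<bar> \<le> 4 * D + 4"
  proof -
    have "\<bar>\<Sum>n\<in>{1..A}. sawtooth (y / (real n + 0) - 0)\<bar> \<le> D"
      "\<bar>\<Sum>n\<in>{1..A}. sawtooth (y / (real n + 0) - \<alpha>)\<bar> \<le> D"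
      "\<bar>\<Sum>n\<in>{1..A}. sawtooth (y / (real n + \<alpha>) - 0)\<bar> \<le> D"
      unfolding D_def by (rule saw; use \<alpha> in simp)+
    then show ?thesis
      using total small v_total[folded u_def] v_corner tail_close[unfolded right_diff_distrib]
      by linarith
  qed
  also have "4 * D + 4 \<le> 127204 * (y powr (1/3) * (1 + ln y) ^ 2)"
  proof -
    have "1 * 1 \<le> y powr (1/3) * (1 + ln y) ^ 2"
      using y1 by (intro mult_mono) (auto intro: ge_one_powr_ge_zero one_le_power)
    then show ?thesis by (simp add: D_def)
  qed
  also have "y powr (1/3) * (1 + ln y) ^ 2 \<le> x powr (1/3) * (1 + ln x) ^ 2"
    using yx y1 x1 by (intro mult_mono powr_mono2 power_mono) auto
  finally show ?thesis unfolding series by (simp add: X_def G_def mult.assoc)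
qed

section \<open>Rearranging the main-term series\<close>

lemma summable_inverse_square_Suc: "summable (\<lambda>k. 1 / real (Suc k) ^ 2)"
  using tail_sum_bounds(1)[of 0 1] by (simp add: power2_eq_square)

lemma inverse_multiple_le:
  assumes "d > 0"
  shows "1 / (real (d * Suc k) * (real (d * Suc k) + 1)) \<le> 1 / real d ^ 2 * (1 / real (Suc k) ^ 2)"
proof -
  have "1 / (real (d * Suc k) * (real (d * Suc k) + 1)) \<le> 1 / (real (d * Suc k) * real (d * Suc k))"
    using assms by (intro divide_left_mono mult_left_mono mult_pos_pos)
      (auto simp del: mult_Suc_right of_nat_Suc intro!: add_nonneg_pos)
  also have "\<dots> = 1 / real d ^ 2 * (1 / real (Suc k) ^ 2)"
    by (simp add: power2_eq_square mult_ac del: mult_Suc_right of_nat_Suc)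
  finally show ?thesis .
qed

lemma summable_inverse_multiples:
  assumes "d > 0"
  shows "summable (\<lambda>k. 1 / (real (d * Suc k) * (real (d * Suc k) + 1)))"
  by (rule summable_comparison_test'[OF summable_mult[OF summable_inverse_square_Suc, of "1 / real d ^ 2"]])
     (use inverse_multiple_le[OF assms] in auto)

text \<open>For positive d this is the limiting proportion of n \<le> x with d dividing [x/n]: the
  value m is taken with proportion 1/m - 1/(m+1), summed here over the multiples m of d.\<close>

definition multiples_density :: "nat \<Rightarrow> real" where
  "multiples_density d = (\<Sum>k. 1 / (real (d * Suc k) * (real (d * Suc k) + 1)))"

lemma multiples_density_nonneg: "multiples_density d \<ge> 0"
proof (cases "d = 0")
  case False
  then show ?thesis unfolding multiples_density_def
    by (intro suminf_nonneg summable_inverse_multiples) auto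
qed (simp add: multiples_density_def)

lemma multiples_density_le:
  assumes "d > 0"
  shows "multiples_density d \<le> (\<Sum>k. 1 / real (Suc k) ^ 2) / real d ^ 2"
proof -
  have "multiples_density d \<le> (\<Sum>k. 1 / real d ^ 2 * (1 / real (Suc k) ^ 2))"
    unfolding multiples_density_def
    by (intro suminf_le inverse_multiple_le summable_inverse_multiples summable_mult
        summable_inverse_square_Suc assms)
  also have "\<dots> = 1 / real d ^ 2 * (\<Sum>k. 1 / real (Suc k) ^ 2)"
    by (rule suminf_mult[OF summable_inverse_square_Suc])
  finally show ?thesis by simp
qed

text \<open>The double series over (i, j) with m = (i+1)(j+1) is dominated by C / ((i+1)^2 (j+1)^2),
  so it may be summed by rows or grouped by the product m.\<close>

lemma divisor_sum_series:
  fixes h :: "nat \<Rightarrow> complex" and C :: real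
  assumes h: "\<And>d. d > 0 \<Longrightarrow> norm (h d) \<le> C"
  shows "(\<lambda>i. h (Suc i) * of_real (multiples_density (Suc i))) sums
      (\<Sum>m. (\<Sum>d | d dvd Suc m. h d) / of_real (real (Suc m) * (real (Suc m) + 1)))"
proof -
  define w where "w n = 1 / (real n * (real n + 1))" for n :: nat
  define H where "H = (\<lambda>(i, j). h (Suc i) * of_real (w (Suc i * Suc j)))"
  define H' where "H' = (\<lambda>(l, i). h (Suc i) * complex_of_real (w (Suc l)))"
  define D where "D l = {i. Suc i dvd Suc l}" for l
  have C0: "C \<ge> 0" using h[of 1] norm_ge_zero[of "h 1"] by linarith
  have sq: "((\<lambda>j. 1 / real (Suc j) ^ 2) has_sum (\<Sum>k. 1 / real (Suc k) ^ 2)) UNIV"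
    using norm_summable_imp_has_sum[OF _ summable_sums[OF summable_inverse_square_Suc]]
      summable_inverse_square_Suc by simp
  have majorant: "(\<lambda>(i, j). C * (1 / real (Suc i) ^ 2) * (1 / real (Suc j) ^ 2)) summable_on UNIV \<times> UNIV"
  proof (rule summable_on_SigmaI)
    fix i
    show "((\<lambda>j. case (i, j) of (i, j) \<Rightarrow> C * (1 / real (Suc i) ^ 2) * (1 / real (Suc j) ^ 2)) has_sum
        C * (1 / real (Suc i) ^ 2) * (\<Sum>k. 1 / real (Suc k) ^ 2)) UNIV"
      unfolding prod.case by (rule has_sum_cmult_right[OF sq])
  next
    show "(\<lambda>i. C * (1 / real (Suc i) ^ 2) * (\<Sum>k. 1 / real (Suc k) ^ 2)) summable_on UNIV"
      by (intro summable_on_cmult_left summable_on_cmult_right has_sum_imp_summable[OF sq])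
  qed (use C0 in auto)
  have "(\<lambda>p. norm (H p)) summable_on UNIV \<times> UNIV"
  proof (rule Infinite_Sum.abs_summable_on_comparison_test)
    show "(\<lambda>p. norm (case p of (i, j) \<Rightarrow> C * (1 / real (Suc i) ^ 2) * (1 / real (Suc j) ^ 2)))
        summable_on UNIV \<times> UNIV"
      by (rule summable_on_iff_abs_summable_on_real[THEN iffD1, OF majorant])
    fix p :: "nat \<times> nat"
    obtain i j where p: "p = (i, j)" by force
    have "norm (h (Suc i)) * w (Suc i * Suc j) \<le> C * (1 / real (Suc i) ^ 2 * (1 / real (Suc j) ^ 2))"
      unfolding w_def using C0 by (intro mult_mono h inverse_multiple_le) auto
    moreover have "0 \<le> w (Suc i * Suc j)" by (simp add: w_def)
    ultimately show "norm (H p) \<le> norm (case p of (i, j) \<Rightarrow> C * (1 / real (Suc i) ^ 2) * (1 / real (Suc j) ^ 2))"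
      using C0 by (simp add: p H_def norm_mult del: of_nat_Suc mult_Suc mult_Suc_right)
  qed
  then have sumH: "H summable_on UNIV \<times> UNIV" by (rule abs_summable_summable)
  have inner: "(\<Sum>\<^sub>\<infinity>j. H (i, j)) = h (Suc i) * of_real (multiples_density (Suc i))" for i
  proof -
    have "((\<lambda>j. w (Suc i * Suc j)) has_sum multiples_density (Suc i)) UNIV"
      unfolding w_def multiples_density_def
      using norm_summable_imp_has_sum[OF _ summable_sums[OF summable_inverse_multiples[of "Suc i"]]]
        summable_inverse_multiples[of "Suc i"] by (simp del: of_nat_Suc mult_Suc mult_Suc_right of_nat_mult)
    then have "((\<lambda>j. H (i, j)) has_sum h (Suc i) * of_real (multiples_density (Suc i))) UNIV"
      unfolding H_def prod.case by (intro has_sum_cmult_right has_sum_of_real)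
    then show ?thesis by (rule infsumI)
  qed
  have "(\<lambda>i. \<Sum>\<^sub>\<infinity>j. H (i, j)) summable_on UNIV"
    using summable_on_Sigma_banach[of "\<lambda>i j. H (i, j)" UNIV "\<lambda>_. UNIV"] sumH by simp
  then have "((\<lambda>i. \<Sum>\<^sub>\<infinity>j. H (i, j)) has_sum infsum H (UNIV \<times> UNIV)) UNIV"
    using has_sum_infsum infsum_Sigma_banach[OF sumH] by metis
  then have sums1: "(\<lambda>i. h (Suc i) * of_real (multiples_density (Suc i))) sums infsum H (UNIV \<times> UNIV)"
    unfolding inner by (rule has_sum_imp_sums)

  \<comment> \<open>Indices are shifted by one: l stands for the product l + 1 and i for its divisor
    i + 1.\<close>
  define \<phi> where "\<phi> = (\<lambda>(i, j). (Suc i * Suc j - 1, i))"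
  have bij: "bij_betw \<phi> (UNIV \<times> UNIV) (Sigma UNIV D)"
  proof (rule bij_betwI[of _ _ _ "\<lambda>(l, i). (i, Suc l div Suc i - 1)"])
    have "Suc i dvd Suc (Suc i * Suc j - 1)" for i j
    proof -
      have eq: "Suc (Suc i * Suc j - 1) = Suc i * Suc j" by simp
      show ?thesis unfolding eq by (rule dvd_triv_left)
    qed
    then show "\<phi> \<in> UNIV \<times> UNIV \<rightarrow> Sigma UNIV D"
      by (auto simp: \<phi>_def D_def simp del: mult_Suc mult_Suc_right)
  next
    fix p :: "nat \<times> nat"
    show "(\<lambda>(l, i). (i, Suc l div Suc i - 1)) (\<phi> p) = p"
      by (cases p) (simp add: \<phi>_def del: mult_Suc mult_Suc_right)
  next
    fix p assume "p \<in> Sigma UNIV D"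
    then obtain l i where p: "p = (l, i)" "Suc i dvd Suc l" by (auto simp: D_def)
    then obtain k where k: "Suc l = Suc i * k" by (elim dvdE)
    then have "k > 0" by (cases k) auto
    then have "Suc (k - 1) = k" by simp
    moreover have "Suc l div Suc i = k" unfolding k by (rule nonzero_mult_div_cancel_left) simp
    moreover have "Suc i * k - 1 = l" using k by linarith
    ultimately show "\<phi> ((\<lambda>(l, i). (i, Suc l div Suc i - 1)) p) = p"
      by (simp add: p(1) \<phi>_def del: mult_Suc mult_Suc_right)
  qed auto
  have H': "H' (\<phi> p) = H p" for p
    by (cases p) (simp add: H_def H'_def \<phi>_def del: mult_Suc mult_Suc_right of_nat_mult)
  have sumH': "H' summable_on Sigma UNIV D"
    using sumH summable_on_reindex_bij_betw[OF bij, of H'] by (simp add: H')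
  have eqH: "infsum H' (Sigma UNIV D) = infsum H (UNIV \<times> UNIV)"
    using infsum_reindex_bij_betw[OF bij, of H'] by (simp add: H')
  have inner': "(\<Sum>\<^sub>\<infinity>i\<in>D l. H' (l, i)) = (\<Sum>d | d dvd Suc l. h d) / of_real (real (Suc l) * (real (Suc l) + 1))" for l
  proof -
    have pos: "d > 0" if "d dvd Suc l" for d
      using that by (rule dvd_pos_nat[rotated]) simp
    have "finite (D l)"
      unfolding D_def by (rule finite_subset[of _ "{..l}"]) (auto dest: dvd_imp_le)
    then have "(\<Sum>\<^sub>\<infinity>i\<in>D l. H' (l, i)) = (\<Sum>i\<in>D l. H' (l, i))" by simp
    also have "\<dots> = (\<Sum>i\<in>D l. h (Suc i)) * of_real (w (Suc l))"
      by (simp add: H'_def sum_distrib_right)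
    also have "(\<Sum>i\<in>D l. h (Suc i)) = (\<Sum>d | d dvd Suc l. h d)"
      by (rule sum.reindex_bij_witness[of _ "\<lambda>d. d - 1" Suc])
         (use pos in \<open>auto simp: D_def\<close>)
    finally show ?thesis by (simp add: w_def)
  qed
  have "(\<lambda>l. \<Sum>\<^sub>\<infinity>i\<in>D l. H' (l, i)) summable_on UNIV"
    using summable_on_Sigma_banach[of "\<lambda>l i. H' (l, i)" UNIV D] sumH' by simp
  then have "((\<lambda>l. \<Sum>\<^sub>\<infinity>i\<in>D l. H' (l, i)) has_sum infsum H (UNIV \<times> UNIV)) UNIV"
    using has_sum_infsum infsum_Sigma_banach[OF sumH'] eqH by metis
  then have "(\<lambda>l. (\<Sum>d | d dvd Suc l. h d) / of_real (real (Suc l) * (real (Suc l) + 1)))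
      sums infsum H (UNIV \<times> UNIV)"
    unfolding inner' by (rule has_sum_imp_sums)
  then show ?thesis using sums1 by (simp only: sums_iff)
qed

section \<open>Summation over d and the final asymptotic formula\<close>

lemma id_conv_div:
  assumes "m > 0"
  shows "id_conv g m / of_nat m = (\<Sum>d | d dvd m. g d / of_nat d)"
proof -
  have "id_conv g m / of_nat m = (\<Sum>d | d dvd m. of_nat d * g (m div d) / of_nat m)"
    by (simp add: id_conv_def sum_divide_distrib)
  also have "\<dots> = (\<Sum>d | d dvd m. g d / of_nat d)"
  proof (rule sum.reindex_bij_witness[of _ "\<lambda>d. m div d" "\<lambda>d. m div d"])
    fix d assume d: "d \<in> {d. d dvd m}"
    then obtain k where k: "m = d * k" by auto
    then show "g (m div d) / of_nat (m div d) = of_nat d * g (m div d) / of_nat m"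
      using assms by (auto simp: field_simps)
  qed (use assms in auto)
  finally show ?thesis .
qed

theorem theorem1p2:
  fixes g :: "nat \<Rightarrow> complex" and \<epsilon> :: real
  assumes g_bound: "\<forall>e>0. \<exists>C. \<forall>n\<ge>1. norm (g n) \<le> C * real n powr e"
    and eps: "\<epsilon> > 0"
  shows "(\<lambda>x::real. (\<Sum>n\<in>{1..nat \<lfloor>x\<rfloor>}.
              id_conv g (nat \<lfloor>x / real n\<rfloor>) / of_nat (nat \<lfloor>x / real n\<rfloor>))
            - of_real x * (\<Sum>m. id_conv g (Suc m) / (of_nat (Suc m) ^ 2 * of_nat (Suc m + 1))))
         \<in> O[at_top](\<lambda>x. of_real (x powr (1/3 + \<epsilon>)))"
proof -
  \<comment> \<open>The cap 1 makes g(d)/d bounded, as the rearrangement requires; half of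
    \<epsilon> is kept for the logarithms.\<close>
  define e where "e = min (\<epsilon> / 2) 1"
  have e: "e > 0" "e \<le> \<epsilon> / 2" "e \<le> 1" using eps by (auto simp: e_def)
  obtain C where C: "\<And>n. n \<ge> 1 \<Longrightarrow> norm (g n) \<le> C * real n powr e" using g_bound e(1) by blast
  have C0: "C \<ge> 0" using C[of 1] norm_ge_zero[of "g 1"] by (simp del: norm_ge_zero)
  define h where "h d = g d / of_nat d" for d
  have hC: "norm (h d) \<le> C" if "d > 0" for d
  proof -
    have "norm (g d) \<le> C * real d powr e" using C that by simp
    also have "\<dots> \<le> C * real d powr 1" using C0 e that by (intro mult_left_mono powr_mono) auto
    finally show ?thesis using that by (simp add: h_def norm_divide divide_le_eq)
  qed
  define M where "M = (\<Sum>m. id_conv g (Suc m) / (of_nat (Suc m) ^ 2 * of_nat (Suc m + 1)))"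
  \<comment> \<open>Sorting the main-term series by d allows a term-by-term comparison with the
    counts \<open>N d\<close> for d \<le> x; the tail d > x is O(1/x) and contributes O(1) after
    multiplication by x.\<close>
  define a where "a i = h (Suc i) * complex_of_real (multiples_density (Suc i))" for i
  have "id_conv g (Suc m) / (of_nat (Suc m) ^ 2 * of_nat (Suc m + 1))
      = (\<Sum>d | d dvd Suc m. h d) / of_real (real (Suc m) * (real (Suc m) + 1))" for m
  proof -
    have "id_conv g (Suc m) / (of_nat (Suc m) ^ 2 * of_nat (Suc m + 1))
        = (id_conv g (Suc m) / of_nat (Suc m)) / (of_nat (Suc m) * (of_nat (Suc m) + 1))"
      by (simp add: power2_eq_square mult.assoc add.commute)
    then show ?thesis unfolding id_conv_div[OF zero_less_Suc] h_def by simp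
  qed
  then have "M = (\<Sum>m. (\<Sum>d | d dvd Suc m. h d) / of_real (real (Suc m) * (real (Suc m) + 1)))"
    unfolding M_def by presburger
  then have a_sums: "a sums M" unfolding a_def using divisor_sum_series[of h C] hC by simp

  define K0 where "K0 = (\<Sum>k. 1 / real (Suc k) ^ 2)"
  have K0: "K0 \<ge> 0" unfolding K0_def by (intro suminf_nonneg summable_inverse_square_Suc) auto
  have a_le: "norm (a i) \<le> C * K0 * (1 / real (Suc i) ^ 2)" for i
  proof -
    have "norm (a i) = norm (h (Suc i)) * multiples_density (Suc i)"
      using multiples_density_nonneg by (simp add: a_def norm_mult)
    also have "\<dots> \<le> C * (K0 / real (Suc i) ^ 2)"
      unfolding K0_def using C0 multiples_density_nonneg
      by (intro mult_mono hC multiples_density_le) auto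
    finally show ?thesis by simp
  qed
  have tail: "norm (\<Sum>i. a (i + X)) \<le> C * K0 * (1 / real X)" if "X > 0" for X
  proof -
    define b where "b i = 1 / real (Suc i) ^ 2" for i
    have b: "summable b" unfolding b_def by (rule summable_inverse_square_Suc)
    have "(\<Sum>i. b (i + X)) = suminf b - (\<Sum>i<X. b i)"
      using suminf_split_initial_segment[OF b, of X] by simp
    also have "\<dots> \<le> 1 / real X"
      using tail_sum_bounds(3)[of 0 X] that by (simp add: b_def[abs_def] power2_eq_square)
    finally have b_le: "(\<Sum>i. b (i + X)) \<le> 1 / real X" .
    have bX: "summable (\<lambda>i. C * K0 * b (i + X))"
      by (intro summable_mult) (use b in \<open>simp add: summable_iff_shift\<close>)
    have "norm (\<Sum>i. a (i + X)) \<le> (\<Sum>i. C * K0 * b (i + X))"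
      unfolding b_def by (intro norm_suminf_le bX[unfolded b_def] a_le)
    also have "\<dots> = C * K0 * (\<Sum>i. b (i + X))"
      by (intro suminf_mult) (use b in \<open>simp add: summable_iff_shift\<close>)
    also have "\<dots> \<le> C * K0 * (1 / real X)" using C0 K0 b_le by (intro mult_left_mono) auto
    finally show ?thesis .
  qed

  \<comment> \<open>Each of three logarithmic factors is bounded by a multiple of x^t, and 3 t =
    \<epsilon>/2 complements \<open>e\<close>.\<close>
  define t where "t = \<epsilon> / 6"
  define K where "K = C * 127204 * (1 + 1 / t) ^ 3 + 2 * (C * K0)"
  have t: "t > 0" using eps by (simp add: t_def)
  have bound: "norm ((\<Sum>n\<in>{1..nat \<lfloor>x\<rfloor>}. id_conv g (nat \<lfloor>x / real n\<rfloor>) / of_nat (nat \<lfloor>x / real n\<rfloor>))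
      - of_real x * M) \<le> K * x powr (1/3 + \<epsilon>)" if x1: "x \<ge> 1" for x
  proof -
    define X where "X = nat \<lfloor>x\<rfloor>"
    define G where "G n = nat \<lfloor>x / real n\<rfloor>" for n
    define N where "N d = (\<Sum>n\<in>{1..X}. of_bool (d dvd G n) :: real)" for d
    have X: "X > 0" "real X \<le> x" "x \<le> 2 * real X"
      using x1 le_twice_nat_floor[OF x1] by (auto simp: X_def)
    have lnx: "ln x \<ge> 0" using x1 by simp
    \<comment> \<open>All quotients lie in [1, X], so one range of d serves every n and the sums can
      be swapped.\<close>
    have "(\<Sum>n\<in>{1..X}. id_conv g (G n) / of_nat (G n)) = (\<Sum>n\<in>{1..X}. \<Sum>d\<in>{1..X}. h d * of_real (of_bool (d dvd G n)))"
    proof (rule sum.cong)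
      fix n assume n: "n \<in> {1..X}"
      have nx: "real n \<le> x" using n X by simp
      have G: "0 < G n" "G n \<le> X"
      proof -
        show "0 < G n" using n nx by (simp add: G_def)
        have "x / real n \<le> x / 1" using n x1 by (intro divide_left_mono) auto
        then show "G n \<le> X" unfolding G_def X_def by (intro nat_mono floor_mono) simp
      qed
      have "id_conv g (G n) / of_nat (G n) = (\<Sum>d | d dvd G n. h d)"
        unfolding h_def by (rule id_conv_div[OF G(1)])
      also have "{d. d dvd G n} = {d\<in>{1..X}. d dvd G n}"
        using G by (auto dest: dvd_imp_le intro: Suc_leI dvd_pos_nat)
      also have "(\<Sum>d | d \<in> {1..X} \<and> d dvd G n. h d) = (\<Sum>d\<in>{1..X}. h d * of_real (of_bool (d dvd G n)))"
        by (subst sum.inter_filter) (auto intro!: sum.cong)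
      finally show "id_conv g (G n) / of_nat (G n) = (\<Sum>d\<in>{1..X}. h d * of_real (of_bool (d dvd G n)))" .
    qed simp
    also have "\<dots> = (\<Sum>d\<in>{1..X}. h d * of_real (N d))"
      unfolding N_def of_real_sum sum_distrib_left by (rule sum.swap)
    finally have S: "(\<Sum>n\<in>{1..X}. id_conv g (G n) / of_nat (G n)) = (\<Sum>d\<in>{1..X}. h d * of_real (N d))" .
    have "M = (\<Sum>i. a (i + X)) + (\<Sum>i<X. a i)"
      using suminf_split_initial_segment[OF sums_summable[OF a_sums], of X] sums_unique[OF a_sums] by simp
    also have "(\<Sum>i<X. a i) = (\<Sum>d\<in>{1..X}. h d * of_real (multiples_density d))"
      unfolding a_def by (rule sum.reindex_bij_witness[of _ "\<lambda>d. d - 1" Suc]) auto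
    finally have diff: "(\<Sum>n\<in>{1..X}. id_conv g (G n) / of_nat (G n)) - of_real x * M
        = (\<Sum>d\<in>{1..X}. h d * of_real (N d - x * multiples_density d)) - of_real x * (\<Sum>i. a (i + X))"
      unfolding S by (simp add: algebra_simps sum_subtractf sum_distrib_left)
    define E where "E = 127204 * x powr (1/3) * (1 + ln x) ^ 2"
    have E0: "E \<ge> 0" by (simp add: E_def)
    have "norm (\<Sum>d\<in>{1..X}. h d * of_real (N d - x * multiples_density d))
        \<le> (\<Sum>d\<in>{1..X}. C * x powr e * E * inverse (real d))"
    proof (rule sum_norm_le)
      fix d assume d: "d \<in> {1..X}"
      have dx: "real d \<le> x" using d X by simp
      have "\<bar>N d - x * multiples_density d\<bar> \<le> E"
        using count_divisible_quotients[of d x] d dx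
        by (simp add: N_def G_def X_def E_def multiples_density_def)
      moreover have "norm (h d) \<le> C * x powr e * inverse (real d)"
      proof -
        have "norm (g d) \<le> C * real d powr e" using C d by simp
        also have "\<dots> \<le> C * x powr e" using C0 e dx by (intro mult_left_mono powr_mono2) auto
        finally have "norm (g d) * inverse (real d) \<le> C * x powr e * inverse (real d)"
          by (rule mult_right_mono) simp
        then show ?thesis by (simp add: h_def norm_divide divide_inverse norm_mult norm_inverse)
      qed
      ultimately have "norm (h d) * \<bar>N d - x * multiples_density d\<bar> \<le> C * x powr e * inverse (real d) * E"
        using C0 by (intro mult_mono) auto
      then show "norm (h d * of_real (N d - x * multiples_density d)) \<le> C * x powr e * E * inverse (real d)"
        by (simp only: norm_mult norm_of_real mult_ac)
    qed
    also have "\<dots> = C * x powr e * E * harm X" by (simp add: harm_def sum_distrib_left)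
    \<comment> \<open>The sum of 1/d supplies the third logarithm, next to the two inside
      \<open>E\<close>.\<close>
    also have "\<dots> \<le> C * x powr e * E * (1 + ln x)"
    proof -
      have "harm X \<le> 1 + ln (real X)"
        using euler_mascheroni_sequence_decreasing[of 1 X] X by (simp add: harm_def)
      also have "ln (real X) \<le> ln x" using X x1 by simp
      finally show ?thesis using C0 E0 by (intro mult_left_mono) auto
    qed
    also have "\<dots> = C * 127204 * (x powr e * x powr (1/3)) * (1 + ln x) ^ 3"
      by (simp add: E_def power2_eq_square power3_eq_cube)
    also have "\<dots> \<le> C * 127204 * (x powr e * x powr (1/3)) * ((1 + 1 / t) * x powr t) ^ 3"
    proof -
      have "ln x \<le> x powr t / t" using ln_powr_bound[OF x1 t] .
      moreover have "1 \<le> x powr t" using x1 t by (simp add: ge_one_powr_ge_zero)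
      ultimately have "1 + ln x \<le> (1 + 1 / t) * x powr t" by (simp add: distrib_right)
      then show ?thesis using C0 lnx by (intro mult_left_mono power_mono) auto
    qed
    also have "\<dots> = C * 127204 * (1 + 1 / t) ^ 3 * x powr (e + 1/3 + 3 * t)"
    proof -
      have "(x powr t) ^ 3 = x powr (3 * t)" using x1 by (simp add: powr_powr mult.commute flip: powr_realpow)
      then show ?thesis by (simp add: power_mult_distrib powr_add)
    qed
    also have "\<dots> \<le> C * 127204 * (1 + 1 / t) ^ 3 * x powr (1/3 + \<epsilon>)"
      using C0 t e x1 by (intro mult_left_mono powr_mono) (auto simp: t_def)
    finally have 1: "norm (\<Sum>d\<in>{1..X}. h d * of_real (N d - x * multiples_density d))
        \<le> C * 127204 * (1 + 1 / t) ^ 3 * x powr (1/3 + \<epsilon>)" .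
    have "norm (of_real x * (\<Sum>i. a (i + X))) = x * norm (\<Sum>i. a (i + X))"
      using x1 by (simp add: norm_mult)
    also have "\<dots> \<le> x * (C * K0 * (1 / real X))"
      using tail[OF X(1)] x1 by (intro mult_left_mono) auto
    also have "\<dots> = C * K0 * (x / real X)" by simp
    also have "\<dots> \<le> C * K0 * 2" using X C0 K0 by (intro mult_left_mono) (auto simp: divide_le_eq)
    also have "\<dots> = 2 * (C * K0) * 1" by simp
    also have "\<dots> \<le> 2 * (C * K0) * x powr (1/3 + \<epsilon>)"
      using C0 K0 eps x1 by (intro mult_left_mono ge_one_powr_ge_zero) auto
    finally have 2: "norm (of_real x * (\<Sum>i. a (i + X))) \<le> 2 * (C * K0) * x powr (1/3 + \<epsilon>)" .
    have "norm ((\<Sum>n\<in>{1..X}. id_conv g (G n) / of_nat (G n)) - of_real x * M) \<le> K * x powr (1/3 + \<epsilon>)"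
      unfolding diff K_def distrib_right by (rule order.trans[OF norm_triangle_ineq4 add_mono[OF 1 2]])
    then show ?thesis by (simp add: G_def X_def)
  qed
  show ?thesis unfolding M_def[symmetric]
  proof (rule bigoI[of _ K], rule eventually_mono[OF eventually_ge_at_top[of 1]])
    fix x :: real assume x: "1 \<le> x"
    have n: "norm (complex_of_real (x powr (1/3 + \<epsilon>))) = x powr (1/3 + \<epsilon>)" by simp
    show "norm ((\<Sum>n\<in>{1..nat \<lfloor>x\<rfloor>}. id_conv g (nat \<lfloor>x / real n\<rfloor>) / of_nat (nat \<lfloor>x / real n\<rfloor>))
      - of_real x * M) \<le> K * norm (complex_of_real (x powr (1/3 + \<epsilon>)))"
      unfolding n by (rule bound[OF x])
  qed
qed

end
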